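(* Let $R$ be a ring, $\sigma$ an endomorphism of $R$, and $I$ a right ideal of $S=R[x;\sigma]$. Suppose that $r_S(I)$ is $\sigma$-stable or that $R$ is $\sigma$-compatible. If $r_S(I)\neq 0$, then $r_R(I)\neq 0$.
   Context: All rings are associative with identity. $R[x;\sigma]$ is the skew polynomial ring: its elements are polynomials in $x$ with coefficients from $R$ written on the left, with multiplication determined by that of $R$ and $xa=\sigma(a)x$ for $a\in R$. For a right ideal $I$ of $S$, $r_S(I)=\{g\in S : Ig=0\}$ and $r_R(I)=\{c\in R : Ic=0\}=r_S(I)\cap R$. For $f=\sum_{i=0}^n a_ix^i\in R[x;\sigma]$ put $\sigma(f)=\sum_{i=0}^n\sigma(a_i)x^i$. The ideal $r_S(I)$ is $\sigma$-stable if $\sigma(r_S(I))\subseteq r_S(I)$. The ring $R$ is $\sigma$-compatible if for all $a,b\in R$, $ab=0$ if and only if $a\sigma(b)=0$. *)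

theory Defs
  imports "HOL-Algebra.UnivPoly"
begin

text \<open>
  The skew polynomial ring \<open>R[x;\<sigma>]\<close>, built on the polynomials \<^term>\<open>UP R\<close>: only the
  multiplication changes. Coefficients stand on the left, so \<open>x a = \<sigma>(a) x\<close> gives
  \<open>(a x^i) (b x^j) = a \<sigma>^i(b) x^(i+j)\<close>.
\<close>

definition skew_UP :: "('a, 'm) ring_scheme \<Rightarrow> ('a \<Rightarrow> 'a) \<Rightarrow> ('a, nat \<Rightarrow> 'a) up_ring"
  where "skew_UP R \<sigma> = (UP R)\<lparr>mult :=
    (\<lambda>p\<in>up R. \<lambda>q\<in>up R. \<lambda>n. \<Oplus>\<^bsub>R\<^esub>i \<in> {..n}. p i \<otimes>\<^bsub>R\<^esub> (\<sigma> ^^ i) (q (n - i)))\<rparr>"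

definition skew_map :: "('a \<Rightarrow> 'a) \<Rightarrow> (nat \<Rightarrow> 'a) \<Rightarrow> (nat \<Rightarrow> 'a)"
  where "skew_map \<sigma> f = (\<lambda>i. \<sigma> (f i))"

definition right_ideal :: "'b set \<Rightarrow> ('b, 'm) ring_scheme \<Rightarrow> bool"
  where "right_ideal I S \<longleftrightarrow> additive_subgroup I S \<and>
    (\<forall>a\<in>I. \<forall>s\<in>carrier S. a \<otimes>\<^bsub>S\<^esub> s \<in> I)"

definition right_annihilator :: "('b, 'm) ring_scheme \<Rightarrow> 'b set \<Rightarrow> 'b set"
  where "right_annihilator S I = {g \<in> carrier S. \<forall>f\<in>I. f \<otimes>\<^bsub>S\<^esub> g = \<zero>\<^bsub>S\<^esub>}"

text \<open>\<open>r_R(I)\<close>, where \<open>R\<close> is embedded in \<open>R[x;\<sigma>]\<close> as the constant polynomials.\<close>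

definition coeff_right_annihilator ::
  "('a, 'm) ring_scheme \<Rightarrow> ('a \<Rightarrow> 'a) \<Rightarrow> (nat \<Rightarrow> 'a) set \<Rightarrow> 'a set"
  where "coeff_right_annihilator R \<sigma> I =
    {c \<in> carrier R. \<forall>f\<in>I.
      f \<otimes>\<^bsub>skew_UP R \<sigma>\<^esub> monom (skew_UP R \<sigma>) c 0 = \<zero>\<^bsub>skew_UP R \<sigma>\<^esub>}"

definition compatible :: "('a, 'm) ring_scheme \<Rightarrow> ('a \<Rightarrow> 'a) \<Rightarrow> bool"
  where "compatible R \<sigma> \<longleftrightarrow> (\<forall>a\<in>carrier R. \<forall>b\<in>carrier R.
    a \<otimes>\<^bsub>R\<^esub> b = \<zero>\<^bsub>R\<^esub> \<longleftrightarrow> a \<otimes>\<^bsub>R\<^esub> \<sigma> b = \<zero>\<^bsub>R\<^esub>)"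


text \<open>
  Checks on the definition of \<^const>\<open>skew_UP\<close>: it is a ring, the constants form a copy of \<open>R\<close>
  in it, and the multiplication satisfies the defining commutation rule.
\<close>

lemma skew_UP_simps:
  "carrier (skew_UP R \<sigma>) = up R"
  "one (skew_UP R \<sigma>) = one (UP R)"
  "zero (skew_UP R \<sigma>) = zero (UP R)"
  "add (skew_UP R \<sigma>) = add (UP R)"
  "monom (skew_UP R \<sigma>) = monom (UP R)"
  by (simp_all add: skew_UP_def UP_def)

lemma skew_UP_mult:
  "p \<in> up R \<Longrightarrow> q \<in> up R \<Longrightarrow>
    p \<otimes>\<^bsub>skew_UP R \<sigma>\<^esub> q = (\<lambda>n. \<Oplus>\<^bsub>R\<^esub>i \<in> {..n}. p i \<otimes>\<^bsub>R\<^esub> (\<sigma> ^^ i) (q (n - i)))"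
  by (simp add: skew_UP_def)

locale skew_poly = ring R for R (structure) +
  fixes \<sigma> assumes endo: "\<sigma> \<in> ring_hom R R"
begin

lemma funpow_hom: "\<sigma> ^^ n \<in> ring_hom R R"
proof (induct n)
  case 0 then show ?case by (simp add: ring_hom_def)
next
  case (Suc n) then show ?case using endo by (auto simp: ring_hom_def Pi_def)
qed

lemmas funpow_closed [simp] = ring_hom_closed [OF funpow_hom]
lemmas funpow_mult = ring_hom_mult [OF funpow_hom]
lemmas funpow_add' = ring_hom_add [OF funpow_hom]
lemmas funpow_one [simp] = ring_hom_one [OF funpow_hom]

lemma funpow_zero [simp]: "(\<sigma> ^^ n) \<zero> = \<zero>"
  using ring_hom_zero [OF funpow_hom] ring_axioms by blast

lemma funpow_finsum:
  fixes f :: "nat \<Rightarrow> 'a"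
  assumes "f \<in> UNIV \<rightarrow> carrier R"
  shows "(\<sigma> ^^ n) (\<Oplus>i\<in>{..k}. f i) = (\<Oplus>i\<in>{..k}. (\<sigma> ^^ n) (f i))"
  using assms by (induct k) (simp_all add: Pi_def funpow_add')

lemma skew_mult_closed:
  assumes "p \<in> up R" "q \<in> up R"
  shows "p \<otimes>\<^bsub>skew_UP R \<sigma>\<^esub> q \<in> up R"
proof -
  have P: "\<And>i. p i \<in> carrier R" and Q: "\<And>i. q i \<in> carrier R" using assms by auto
  obtain n m where n: "bound \<zero> n p" and m: "bound \<zero> m q" using assms by fast
  have "bound \<zero> (n + m) (\<lambda>k. \<Oplus>i \<in> {..k}. p i \<otimes> (\<sigma> ^^ i) (q (k - i)))"
  proof
    fix k assume k: "n + m < k"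
    have "p i \<otimes> (\<sigma> ^^ i) (q (k - i)) = \<zero>" for i
    proof (cases "n < i")
      case True
      then have "p i = \<zero>" using n by auto
      then show ?thesis using Q by simp
    next
      case False
      then have "q (k - i) = \<zero>" using k m by (simp add: bound.bound)
      then show ?thesis using P by simp
    qed
    then show "(\<Oplus>i \<in> {..k}. p i \<otimes> (\<sigma> ^^ i) (q (k - i))) = \<zero>" by simp
  qed
  then show ?thesis using assms P Q by (auto simp: skew_UP_mult intro!: mem_upI)
qed

lemma skew_mult_assoc_aux:
  assumes A: "\<And>i. a i \<in> carrier R" and B: "\<And>i. b i \<in> carrier R" and C: "\<And>i. c i \<in> carrier R"
  shows "k \<le> n \<Longrightarrow>
    (\<Oplus>j\<in>{..k}. (\<Oplus>i\<in>{..j}. a i \<otimes> (\<sigma> ^^ i) (b (j - i))) \<otimes> (\<sigma> ^^ j) (c (n - j))) =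
    (\<Oplus>j\<in>{..k}. a j \<otimes> (\<sigma> ^^ j) (\<Oplus>i\<in>{..k-j}. b i \<otimes> (\<sigma> ^^ i) (c (n - j - i))))"
proof (induct k)
  case 0 then show ?case using A B C by (simp add: m_assoc)
next
  case (Suc k)
  let ?in = "\<lambda>k j. \<Oplus>i\<in>{..k-j}. b i \<otimes> (\<sigma> ^^ i) (c (n - j - i))"
  let ?c = "(\<sigma> ^^ Suc k) (c (n - Suc k))"
  let ?t = "\<lambda>j. a j \<otimes> (\<sigma> ^^ j) (b (Suc k - j)) \<otimes> ?c"
  have cc: "?c \<in> carrier R" by (rule funpow_closed) (rule C)
  have inc: "?in k j \<in> carrier R" for k j using B C by (auto intro!: finsum_closed)
  have sc: "(\<sigma> ^^ j) (c i) \<in> carrier R" "(\<sigma> ^^ j) (b i) \<in> carrier R" for i j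
    using B C by (auto intro!: funpow_closed)
  have step: "a j \<otimes> (\<sigma> ^^ j) (?in (Suc k) j) = a j \<otimes> (\<sigma> ^^ j) (?in k j) \<oplus> ?t j"
    if "j \<le> k" for j
  proof -
    have e: "Suc k - j = Suc (k - j)" "n - j - Suc (k - j) = n - Suc k" using that by auto
    have "?in (Suc k) j = b (Suc k - j) \<otimes> (\<sigma> ^^ (Suc k - j)) (c (n - Suc k)) \<oplus> ?in k j"
      unfolding e(1) using B sc e(2) by (subst finsum_Suc) auto
    then have "(\<sigma> ^^ j) (?in (Suc k) j) =
        (\<sigma> ^^ j) (b (Suc k - j) \<otimes> (\<sigma> ^^ (Suc k - j)) (c (n - Suc k))) \<oplus> (\<sigma> ^^ j) (?in k j)"
      using inc B sc by (simp only: funpow_add' m_closed)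
    also have "(\<sigma> ^^ j) (b (Suc k - j) \<otimes> (\<sigma> ^^ (Suc k - j)) (c (n - Suc k))) =
        (\<sigma> ^^ j) (b (Suc k - j)) \<otimes> (\<sigma> ^^ j) ((\<sigma> ^^ (Suc k - j)) (c (n - Suc k)))"
      using B sc by (simp only: funpow_mult)
    also have "(\<sigma> ^^ j) ((\<sigma> ^^ (Suc k - j)) (c (n - Suc k))) = ?c"
      using that funpow_add [of j "Suc k - j" \<sigma>] by (simp del: funpow.simps)
    finally show ?thesis
      using A sc cc funpow_closed [OF inc] by (simp only: r_distr m_assoc m_closed a_comm)
  qed
  have T: "?t j \<in> carrier R" for j using A sc cc by blast
  have U: "a j \<otimes> (\<sigma> ^^ j) (?in k j) \<in> carrier R" for j k
    using A funpow_closed [OF inc] by blast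
  have last: "a (Suc k) \<otimes> (\<sigma> ^^ Suc k) (?in (Suc k) (Suc k)) = ?t (Suc k)"
  proof -
    have "?in (Suc k) (Suc k) = b 0 \<otimes> c (n - Suc k)" using B C by simp
    then show ?thesis using A B C sc cc by (simp only: funpow_mult m_assoc diff_self_eq_0)
  qed
  have "(\<Oplus>j\<in>{..Suc k}. a j \<otimes> (\<sigma> ^^ j) (?in (Suc k) j)) =
     ?t (Suc k) \<oplus> (\<Oplus>j\<in>{..k}. a j \<otimes> (\<sigma> ^^ j) (?in (Suc k) j))"
    using U last by (subst finsum_Suc) auto
  also have "(\<Oplus>j\<in>{..k}. a j \<otimes> (\<sigma> ^^ j) (?in (Suc k) j)) =
      (\<Oplus>j\<in>{..k}. a j \<otimes> (\<sigma> ^^ j) (?in k j) \<oplus> ?t j)"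
    using step U T by (intro finsum_cong') auto
  also have "\<dots> = (\<Oplus>j\<in>{..k}. a j \<otimes> (\<sigma> ^^ j) (?in k j)) \<oplus> (\<Oplus>j\<in>{..k}. ?t j)"
    using U T by (intro finsum_addf) auto
  finally have R: "(\<Oplus>j\<in>{..Suc k}. a j \<otimes> (\<sigma> ^^ j) (?in (Suc k) j)) =
     ?t (Suc k) \<oplus> ((\<Oplus>j\<in>{..k}. a j \<otimes> (\<sigma> ^^ j) (?in k j)) \<oplus> (\<Oplus>j\<in>{..k}. ?t j))" .
  let ?s = "\<lambda>j. (\<Oplus>i\<in>{..j}. a i \<otimes> (\<sigma> ^^ i) (b (j - i))) \<otimes> (\<sigma> ^^ j) (c (n - j))"
  have S: "?s j \<in> carrier R" for j using A sc by (auto intro!: finsum_closed m_closed)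
  have "(\<Oplus>j\<in>{..Suc k}. ?s j) = ?s (Suc k) \<oplus> (\<Oplus>j\<in>{..k}. ?s j)"
    using S by (subst finsum_Suc) auto
  also have "?s (Suc k) = (\<Oplus>j\<in>{..Suc k}. ?t j)"
    using A sc cc by (intro finsum_ldistr) auto
  also have "\<dots> = ?t (Suc k) \<oplus> (\<Oplus>j\<in>{..k}. ?t j)"
    using T by (subst finsum_Suc) auto
  also have "(\<Oplus>j\<in>{..k}. ?s j) = (\<Oplus>j\<in>{..k}. a j \<otimes> (\<sigma> ^^ j) (?in k j))"
    using Suc by simp
  finally have L: "(\<Oplus>j\<in>{..Suc k}. ?s j) = ?t (Suc k) \<oplus> (\<Oplus>j\<in>{..k}. ?t j) \<oplus>
    (\<Oplus>j\<in>{..k}. a j \<otimes> (\<sigma> ^^ j) (?in k j))" .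
  have "(\<Oplus>j\<in>{..k}. ?t j) \<in> carrier R" using T by (intro finsum_closed) auto
  moreover have "(\<Oplus>j\<in>{..k}. a j \<otimes> (\<sigma> ^^ j) (?in k j)) \<in> carrier R"
    using U by (intro finsum_closed) auto
  ultimately show ?case unfolding L R using T [of "Suc k"] by (simp only: a_ac a_closed)
qed

theorem skew_UP_ring: "ring (skew_UP R \<sigma>)"
proof -
  interpret P: UP_ring R "UP R" by (unfold_locales) simp
  let ?S = "skew_UP R \<sigma>"
  have car: "carrier (UP R) = up R" by (simp add: UP_def)
  have one: "\<one>\<^bsub>UP R\<^esub> = (\<lambda>i. if i = 0 then \<one> else \<zero>)" by (simp add: UP_def)
  have add: "p \<oplus>\<^bsub>UP R\<^esub> q = (\<lambda>i. p i \<oplus> q i)" if "p \<in> up R" "q \<in> up R" for p q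
    using that by (simp add: UP_def)
  have "abelian_group ?S"
    by (rule abelian_groupI)
       (use P.UP_a_closed P.UP_zero_closed P.UP_a_assoc P.UP_a_comm P.UP_l_zero P.UP_l_neg_ex
         in \<open>simp_all add: skew_UP_simps car\<close>)
  moreover have "monoid ?S"
  proof (rule monoidI)
    show "p \<otimes>\<^bsub>?S\<^esub> q \<in> carrier ?S" if "p \<in> carrier ?S" "q \<in> carrier ?S" for p q
      using that skew_mult_closed by (simp add: skew_UP_simps)
    show "\<one>\<^bsub>?S\<^esub> \<in> carrier ?S" using P.UP_one_closed by (simp add: skew_UP_simps car)
    show "p \<otimes>\<^bsub>?S\<^esub> q \<otimes>\<^bsub>?S\<^esub> r = p \<otimes>\<^bsub>?S\<^esub> (q \<otimes>\<^bsub>?S\<^esub> r)"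
      if "p \<in> carrier ?S" "q \<in> carrier ?S" "r \<in> carrier ?S" for p q r
    proof -
      have m: "p \<in> up R" "q \<in> up R" "r \<in> up R" using that by (simp_all add: skew_UP_simps)
      have "(p \<otimes>\<^bsub>?S\<^esub> q \<otimes>\<^bsub>?S\<^esub> r) n = (p \<otimes>\<^bsub>?S\<^esub> (q \<otimes>\<^bsub>?S\<^esub> r)) n" for n
      proof -
        have "(p \<otimes>\<^bsub>?S\<^esub> q \<otimes>\<^bsub>?S\<^esub> r) n =
            (\<Oplus>j\<in>{..n}. (p \<otimes>\<^bsub>?S\<^esub> q) j \<otimes> (\<sigma> ^^ j) (r (n - j)))"
          by (simp only: skew_UP_mult [OF skew_mult_closed [OF m(1,2)] m(3)])
        also have "\<dots> = (\<Oplus>j\<in>{..n}. p j \<otimes> (\<sigma> ^^ j) ((q \<otimes>\<^bsub>?S\<^esub> r) (n - j)))"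
          unfolding skew_UP_mult [OF m(1,2)] skew_UP_mult [OF m(2,3)]
          by (rule skew_mult_assoc_aux) (use m in auto)
        also have "\<dots> = (p \<otimes>\<^bsub>?S\<^esub> (q \<otimes>\<^bsub>?S\<^esub> r)) n"
          by (simp only: skew_UP_mult [OF m(1) skew_mult_closed [OF m(2,3)]])
        finally show ?thesis .
      qed
      then show ?thesis by (rule ext)
    qed
    show "\<one>\<^bsub>?S\<^esub> \<otimes>\<^bsub>?S\<^esub> p = p" if "p \<in> carrier ?S" for p
    proof
      fix n
      have m: "p \<in> up R" using that by (simp add: skew_UP_simps)
      have "(\<one>\<^bsub>?S\<^esub> \<otimes>\<^bsub>?S\<^esub> p) n = (\<Oplus>i\<in>{..n}. (if i = 0 then \<one> else \<zero>) \<otimes> (\<sigma> ^^ i) (p (n - i)))"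
        using skew_UP_mult [OF up_one_closed m] by (simp add: skew_UP_simps one)
      also have "\<dots> = (\<Oplus>i\<in>{..n}. if 0 = i then p n else \<zero>)"
        using mem_upD [OF m] by (intro finsum_cong') auto
      also have "\<dots> = p n"
        using mem_upD [OF m] finsum_singleton [of 0 "{..n}" "\<lambda>_. p n"] by auto
      finally show "(\<one>\<^bsub>?S\<^esub> \<otimes>\<^bsub>?S\<^esub> p) n = p n" .
    qed
    show "p \<otimes>\<^bsub>?S\<^esub> \<one>\<^bsub>?S\<^esub> = p" if "p \<in> carrier ?S" for p
    proof
      fix n
      have m: "p \<in> up R" using that by (simp add: skew_UP_simps)
      have "(p \<otimes>\<^bsub>?S\<^esub> \<one>\<^bsub>?S\<^esub>) n = (\<Oplus>i\<in>{..n}. p i \<otimes> (\<sigma> ^^ i) (if n - i = 0 then \<one> else \<zero>))"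
        using skew_UP_mult [OF m up_one_closed] by (simp add: skew_UP_simps one)
      also have "\<dots> = (\<Oplus>i\<in>{..n}. if n = i then p i else \<zero>)"
        using mem_upD [OF m] by (intro finsum_cong') auto
      also have "\<dots> = p n"
        using mem_upD [OF m] finsum_singleton [of n "{..n}" p] by auto
      finally show "(p \<otimes>\<^bsub>?S\<^esub> \<one>\<^bsub>?S\<^esub>) n = p n" .
    qed
  qed
  moreover have "(p \<oplus>\<^bsub>?S\<^esub> q) \<otimes>\<^bsub>?S\<^esub> r = p \<otimes>\<^bsub>?S\<^esub> r \<oplus>\<^bsub>?S\<^esub> q \<otimes>\<^bsub>?S\<^esub> r"
    if "p \<in> carrier ?S" "q \<in> carrier ?S" "r \<in> carrier ?S" for p q r
  proof
    fix n
    have m: "p \<in> up R" "q \<in> up R" "r \<in> up R" using that by (simp_all add: skew_UP_simps)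
    have "((p \<oplus>\<^bsub>?S\<^esub> q) \<otimes>\<^bsub>?S\<^esub> r) n = (\<Oplus>i\<in>{..n}. (p i \<oplus> q i) \<otimes> (\<sigma> ^^ i) (r (n - i)))"
      using skew_UP_mult [OF up_add_closed [OF m(1,2)] m(3)] m by (simp add: skew_UP_simps add)
    also have "\<dots> = (\<Oplus>i\<in>{..n}. p i \<otimes> (\<sigma> ^^ i) (r (n - i)) \<oplus> q i \<otimes> (\<sigma> ^^ i) (r (n - i)))"
      using m [THEN mem_upD] by (intro finsum_cong') (simp_all add: l_distr)
    also have "\<dots> = (p \<otimes>\<^bsub>?S\<^esub> r) n \<oplus> (q \<otimes>\<^bsub>?S\<^esub> r) n"
      unfolding skew_UP_mult [OF m(1,3)] skew_UP_mult [OF m(2,3)]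
      using m [THEN mem_upD] by (intro finsum_addf) simp_all
    also have "\<dots> = (p \<otimes>\<^bsub>?S\<^esub> r \<oplus>\<^bsub>?S\<^esub> q \<otimes>\<^bsub>?S\<^esub> r) n"
      by (simp only: skew_UP_simps add [OF skew_mult_closed [OF m(1,3)] skew_mult_closed [OF m(2,3)]])
    finally show "((p \<oplus>\<^bsub>?S\<^esub> q) \<otimes>\<^bsub>?S\<^esub> r) n = (p \<otimes>\<^bsub>?S\<^esub> r \<oplus>\<^bsub>?S\<^esub> q \<otimes>\<^bsub>?S\<^esub> r) n" .
  qed
  moreover have "r \<otimes>\<^bsub>?S\<^esub> (p \<oplus>\<^bsub>?S\<^esub> q) = r \<otimes>\<^bsub>?S\<^esub> p \<oplus>\<^bsub>?S\<^esub> r \<otimes>\<^bsub>?S\<^esub> q"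
    if "p \<in> carrier ?S" "q \<in> carrier ?S" "r \<in> carrier ?S" for p q r
  proof
    fix n
    have m: "p \<in> up R" "q \<in> up R" "r \<in> up R" using that by (simp_all add: skew_UP_simps)
    have "(r \<otimes>\<^bsub>?S\<^esub> (p \<oplus>\<^bsub>?S\<^esub> q)) n = (\<Oplus>i\<in>{..n}. r i \<otimes> (\<sigma> ^^ i) (p (n - i) \<oplus> q (n - i)))"
      using skew_UP_mult [OF m(3) up_add_closed [OF m(1,2)]] m by (simp add: skew_UP_simps add)
    also have "\<dots> = (\<Oplus>i\<in>{..n}. r i \<otimes> (\<sigma> ^^ i) (p (n - i)) \<oplus> r i \<otimes> (\<sigma> ^^ i) (q (n - i)))"
      using m [THEN mem_upD] by (intro finsum_cong') (simp_all add: r_distr funpow_add')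
    also have "\<dots> = (r \<otimes>\<^bsub>?S\<^esub> p) n \<oplus> (r \<otimes>\<^bsub>?S\<^esub> q) n"
      unfolding skew_UP_mult [OF m(3,1)] skew_UP_mult [OF m(3,2)]
      using m [THEN mem_upD] by (intro finsum_addf) simp_all
    also have "\<dots> = (r \<otimes>\<^bsub>?S\<^esub> p \<oplus>\<^bsub>?S\<^esub> r \<otimes>\<^bsub>?S\<^esub> q) n"
      by (simp only: skew_UP_simps add [OF skew_mult_closed [OF m(3,1)] skew_mult_closed [OF m(3,2)]])
    finally show "(r \<otimes>\<^bsub>?S\<^esub> (p \<oplus>\<^bsub>?S\<^esub> q)) n = (r \<otimes>\<^bsub>?S\<^esub> p \<oplus>\<^bsub>?S\<^esub> r \<otimes>\<^bsub>?S\<^esub> q) n" .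
  qed
  ultimately show ?thesis by (rule ringI)
qed

lemma monom_up: "a \<in> carrier R \<Longrightarrow> (\<lambda>i. if i = n then a else \<zero>) \<in> up R"
  by (auto intro!: mem_upI exI [of _ n])

lemma monom_mult:
  assumes a: "a \<in> carrier R" and b: "b \<in> carrier R"
  shows "monom (skew_UP R \<sigma>) a m \<otimes>\<^bsub>skew_UP R \<sigma>\<^esub> monom (skew_UP R \<sigma>) b n =
    monom (skew_UP R \<sigma>) (a \<otimes> (\<sigma> ^^ m) b) (m + n)"
proof
  fix k
  have mon: "monom (skew_UP R \<sigma>) c l = (\<lambda>i. if i = l then c else \<zero>)" if "c \<in> carrier R" for c l
    using that by (simp add: skew_UP_simps UP_def)
  have "(monom (skew_UP R \<sigma>) a m \<otimes>\<^bsub>skew_UP R \<sigma>\<^esub> monom (skew_UP R \<sigma>) b n) k =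
      (\<Oplus>i\<in>{..k}. (if i = m then a else \<zero>) \<otimes> (\<sigma> ^^ i) (if k - i = n then b else \<zero>))"
    using a b by (simp add: mon skew_UP_mult monom_up)
  also have "\<dots> = (\<Oplus>i\<in>{..k}. if m = i then a \<otimes> (\<sigma> ^^ m) (if k - m = n then b else \<zero>) else \<zero>)"
    using a b by (intro finsum_cong') auto
  also have "\<dots> = (if k = m + n then a \<otimes> (\<sigma> ^^ m) b else \<zero>)"
  proof (cases "m \<le> k")
    case True
    then show ?thesis
      using a b finsum_singleton [of m "{..k}" "\<lambda>_. a \<otimes> (\<sigma> ^^ m) (if k - m = n then b else \<zero>)"]
      by auto
  next
    case False
    then have "(\<Oplus>i\<in>{..k}. if m = i then a \<otimes> (\<sigma> ^^ m) (if k - m = n then b else \<zero>) else \<zero>) =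
        (\<Oplus>i\<in>{..k}. \<zero>)"
      by (intro finsum_cong') auto
    then show ?thesis using False by simp
  qed
  finally show "(monom (skew_UP R \<sigma>) a m \<otimes>\<^bsub>skew_UP R \<sigma>\<^esub> monom (skew_UP R \<sigma>) b n) k =
      monom (skew_UP R \<sigma>) (a \<otimes> (\<sigma> ^^ m) b) (m + n) k"
    using a b by (simp add: mon)
qed

lemma x_commute:
  assumes "a \<in> carrier R"
  shows "monom (skew_UP R \<sigma>) \<one> 1 \<otimes>\<^bsub>skew_UP R \<sigma>\<^esub> monom (skew_UP R \<sigma>) a 0 =
    monom (skew_UP R \<sigma>) (\<sigma> a) 0 \<otimes>\<^bsub>skew_UP R \<sigma>\<^esub> monom (skew_UP R \<sigma>) \<one> 1"
  using assms ring_hom_closed [OF endo assms] by (simp add: monom_mult)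

lemma const_embedding:
  shows "(\<lambda>a. monom (skew_UP R \<sigma>) a 0) \<in> ring_hom R (skew_UP R \<sigma>)"
    and "inj_on (\<lambda>a. monom (skew_UP R \<sigma>) a 0) (carrier R)"
proof -
  show "(\<lambda>a. monom (skew_UP R \<sigma>) a 0) \<in> ring_hom R (skew_UP R \<sigma>)"
  proof (rule ring_hom_memI)
    show "monom (skew_UP R \<sigma>) (x \<otimes> y) 0 =
        monom (skew_UP R \<sigma>) x 0 \<otimes>\<^bsub>skew_UP R \<sigma>\<^esub> monom (skew_UP R \<sigma>) y 0"
      if "x \<in> carrier R" "y \<in> carrier R" for x y
      using that by (simp add: monom_mult)
  qed (auto simp: skew_UP_simps UP_def monom_up)
  show "inj_on (\<lambda>a. monom (skew_UP R \<sigma>) a 0) (carrier R)"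
    by (auto simp: inj_on_def skew_UP_simps UP_def dest: fun_cong [of _ _ 0])
qed

end

end

theory Submission
  imports Defs
begin

text \<open>
  McCoy's argument: take a nonzero annihilating polynomial \<open>g\<close> of least degree \<open>m\<close>, with leading
  coefficient \<open>b\<close>. For \<open>f = \<Sum>i. a\<^sub>i x^i\<close> in \<open>I\<close> one shows by descending induction on \<open>k\<close> that
  \<open>a\<^sub>k x^k g = 0\<close>: the coefficient of \<open>x^(k+m)\<close> in \<open>f g = 0\<close> gives \<open>a\<^sub>k \<sigma>^k(b) = 0\<close>, so
  \<open>a\<^sub>k \<sigma>^k(g)\<close> (if the annihilator is stable) or \<open>a\<^sub>k g\<close> (if \<open>R\<close> is compatible) is an annihilating
  polynomial of degree less than \<open>m\<close>, hence zero. In particular \<open>f b = \<Sum>i. a\<^sub>i \<sigma>^i(b) x^i = 0\<close>.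
\<close>

text \<open>Compatibility is used once per factor \<sigma>. Peeling off the innermost one leaves
  \<open>(\<sigma> ^^ n) (\<sigma> b)\<close>, hence the induction over arbitrary
  \<open>b\<close>.\<close>

lemma compatible_funpow:
  assumes "compatible R \<sigma>" "\<sigma> \<in> ring_hom R R" "a \<in> carrier R" "b \<in> carrier R"
  shows "a \<otimes>\<^bsub>R\<^esub> (\<sigma> ^^ n) b = \<zero>\<^bsub>R\<^esub> \<longleftrightarrow> a \<otimes>\<^bsub>R\<^esub> b = \<zero>\<^bsub>R\<^esub>"
  using assms(4)
proof (induct n arbitrary: b)
  case (Suc n)
  then show ?case
    using assms ring_hom_closed [OF assms(2) Suc.prems]
    by (simp add: funpow_Suc_right compatible_def del: funpow.simps)
qed simp

lemma skew_map_funpow: "(skew_map \<sigma> ^^ n) f = (\<lambda>i. (\<sigma> ^^ n) (f i))"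
  by (induct n) (simp_all add: skew_map_def)

context skew_poly
begin

lemma zero_eq: "\<zero>\<^bsub>skew_UP R \<sigma>\<^esub> = (\<lambda>i. \<zero>)"
  by (simp add: skew_UP_simps UP_def)

lemma monom_eq: "c \<in> carrier R \<Longrightarrow> monom (skew_UP R \<sigma>) c n = (\<lambda>i. if i = n then c else \<zero>)"
  by (simp add: skew_UP_simps UP_def)

lemma const_mult:
  assumes c: "c \<in> carrier R" and g: "g \<in> up R"
  shows "monom (skew_UP R \<sigma>) c 0 \<otimes>\<^bsub>skew_UP R \<sigma>\<^esub> g = (\<lambda>n. c \<otimes> g n)"
proof
  fix n
  have "(\<Oplus>i\<in>{..n}. (if i = 0 then c else \<zero>) \<otimes> (\<sigma> ^^ i) (g (n - i))) =
      (\<Oplus>i\<in>{..n}. if 0 = i then c \<otimes> g n else \<zero>)"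
    using c mem_upD [OF g] by (intro finsum_cong') auto
  also have "\<dots> = c \<otimes> g n"
    using c mem_upD [OF g] finsum_singleton [of 0 "{..n}" "\<lambda>_. c \<otimes> g n"] by auto
  finally show "(monom (skew_UP R \<sigma>) c 0 \<otimes>\<^bsub>skew_UP R \<sigma>\<^esub> g) n = c \<otimes> g n"
    using c g by (simp add: monom_eq skew_UP_mult monom_up)
qed

text \<open>A constant on the right must cross \<open>x^n\<close> and becomes
  \<open>(\<sigma> ^^ n) c\<close>; one on the left crosses nothing.\<close>

lemma mult_const:
  assumes c: "c \<in> carrier R" and f: "f \<in> up R"
  shows "f \<otimes>\<^bsub>skew_UP R \<sigma>\<^esub> monom (skew_UP R \<sigma>) c 0 = (\<lambda>n. f n \<otimes> (\<sigma> ^^ n) c)"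
proof
  fix n
  have "(\<Oplus>i\<in>{..n}. f i \<otimes> (\<sigma> ^^ i) (if n - i = 0 then c else \<zero>)) =
      (\<Oplus>i\<in>{..n}. if n = i then f i \<otimes> (\<sigma> ^^ i) c else \<zero>)"
    using c mem_upD [OF f] by (intro finsum_cong') auto
  also have "\<dots> = f n \<otimes> (\<sigma> ^^ n) c"
    using c mem_upD [OF f] finsum_singleton [of n "{..n}" "\<lambda>i. f i \<otimes> (\<sigma> ^^ i) c"] by auto
  finally show "(f \<otimes>\<^bsub>skew_UP R \<sigma>\<^esub> monom (skew_UP R \<sigma>) c 0) n = f n \<otimes> (\<sigma> ^^ n) c"
    using c f by (simp add: monom_eq skew_UP_mult monom_up)
qed

lemma right_ideal_subset: "right_ideal I (skew_UP R \<sigma>) \<Longrightarrow> I \<subseteq> up R"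
  using additive_subgroup.a_subset [of I "skew_UP R \<sigma>"]
  by (simp add: right_ideal_def skew_UP_simps)

text \<open>Excludes the empty set, so that an annihilator other than \<open>{\<zero>}\<close> has a
  nonzero element.\<close>

lemma zero_in_right_annihilator:
  assumes "right_ideal I (skew_UP R \<sigma>)"
  shows "\<zero>\<^bsub>skew_UP R \<sigma>\<^esub> \<in> right_annihilator (skew_UP R \<sigma>) I"
proof -
  interpret S: ring "skew_UP R \<sigma>" by (rule skew_UP_ring)
  show ?thesis
    using right_ideal_subset [OF assms] S.zero_closed S.r_null
    unfolding right_annihilator_def skew_UP_simps(1) by blast
qed

text \<open>For \<open>f\<close> in \<open>I\<close>, absorption puts \<open>f c\<close> in
  \<open>I\<close>, and \<open>f (c g) = (f c) g = 0\<close>.\<close>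

lemma const_mult_in_right_annihilator:
  assumes I: "right_ideal I (skew_UP R \<sigma>)" and c: "c \<in> carrier R"
    and g: "g \<in> right_annihilator (skew_UP R \<sigma>) I"
  shows "(\<lambda>n. c \<otimes> g n) \<in> right_annihilator (skew_UP R \<sigma>) I"
proof -
  interpret S: ring "skew_UP R \<sigma>" by (rule skew_UP_ring)
  let ?c = "monom (skew_UP R \<sigma>) c 0"
  have cS: "?c \<in> carrier (skew_UP R \<sigma>)"
    using c by (simp add: skew_UP_simps(1) monom_eq monom_up)
  have gS: "g \<in> carrier (skew_UP R \<sigma>)" using g by (simp add: right_annihilator_def)
  have "f \<otimes>\<^bsub>skew_UP R \<sigma>\<^esub> (?c \<otimes>\<^bsub>skew_UP R \<sigma>\<^esub> g) = \<zero>\<^bsub>skew_UP R \<sigma>\<^esub>" if f: "f \<in> I" for f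
  proof -
    have fS: "f \<in> carrier (skew_UP R \<sigma>)"
      using right_ideal_subset [OF I] f by (auto simp: skew_UP_simps(1))
    have "f \<otimes>\<^bsub>skew_UP R \<sigma>\<^esub> ?c \<in> I" using I f cS by (simp add: right_ideal_def)
    then show ?thesis
      using g S.m_assoc [OF fS cS gS] by (simp add: right_annihilator_def)
  qed
  then have "?c \<otimes>\<^bsub>skew_UP R \<sigma>\<^esub> g \<in> right_annihilator (skew_UP R \<sigma>) I"
    using S.m_closed [OF cS gS] by (simp add: right_annihilator_def)
  then show ?thesis using const_mult [OF c] gS by (simp add: skew_UP_simps(1))
qed

text \<open>The assumption \<open>lead\<close> captures what the stable and the compatible case have
  in common, so one descending induction serves both.\<close>

lemma mult_zero_coeff:
  assumes f: "f \<in> up R" and g: "g \<in> up R"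
    and fg: "f \<otimes>\<^bsub>skew_UP R \<sigma>\<^esub> g = \<zero>\<^bsub>skew_UP R \<sigma>\<^esub>"
    and deg: "\<And>j. m < j \<Longrightarrow> g j = \<zero>"
    and lead: "\<And>c k j. c \<in> carrier R \<Longrightarrow> c \<otimes> (\<sigma> ^^ k) (g m) = \<zero> \<Longrightarrow> c \<otimes> (\<sigma> ^^ k) (g j) = \<zero>"
  shows "f k \<otimes> (\<sigma> ^^ k) (g j) = \<zero>"
proof -
  note F = mem_upD [OF f] and G = mem_upD [OF g]
  obtain n where n: "bound \<zero> n f" using f by fast
  show ?thesis
  \<comment> \<open>With \<open>Suc n\<close> rather than \<open>n\<close>, the measure still drops
    from \<open>k = n\<close> to indices beyond \<open>n\<close>, where \<open>f\<close>
    vanishes.\<close>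
  proof (induct "Suc n - k" arbitrary: k j rule: less_induct)
    case less
    show ?case
    proof (cases "n < k")
      case True
      then show ?thesis using n G by (simp add: bound.bound)
    next
      case False
      have IH: "f i \<otimes> (\<sigma> ^^ i) (g j) = \<zero>" if "k < i" for i j
        using less [of i j] that False by auto
      \<comment> \<open>Terms with \<open>i > k\<close> vanish by induction; for
        \<open>i < k\<close> the index \<open>k + m - i\<close> exceeds \<open>m\<close>.\<close>
      have "f i \<otimes> (\<sigma> ^^ i) (g (k + m - i)) = \<zero>" if "i \<le> k + m" "i \<noteq> k" for i
        using that IH deg [of "k + m - i"] F by (cases "k < i") auto
      then have "(\<Oplus>i\<in>{..k + m}. f i \<otimes> (\<sigma> ^^ i) (g (k + m - i))) =
          (\<Oplus>i\<in>{..k + m}. if k = i then f i \<otimes> (\<sigma> ^^ i) (g m) else \<zero>)"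
        using F G by (intro finsum_cong') auto
      also have "\<dots> = f k \<otimes> (\<sigma> ^^ k) (g m)"
        using F G finsum_singleton [of k "{..k + m}" "\<lambda>i. f i \<otimes> (\<sigma> ^^ i) (g m)"] by auto
      finally have "f k \<otimes> (\<sigma> ^^ k) (g m) = \<zero>"
        using fun_cong [OF fg, of "k + m"] f g by (simp add: skew_UP_mult zero_eq)
      then show ?thesis using lead F by blast
    qed
  qed
qed

theorem coeff_right_annihilator_nonzero:
  assumes I: "right_ideal I (skew_UP R \<sigma>)"
    and stable: "skew_map \<sigma> ` right_annihilator (skew_UP R \<sigma>) I \<subseteq> right_annihilator (skew_UP R \<sigma>) I
      \<or> compatible R \<sigma>"
    and nonzero: "right_annihilator (skew_UP R \<sigma>) I \<noteq> {\<zero>\<^bsub>skew_UP R \<sigma>\<^esub>}"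
  shows "\<exists>b \<in> coeff_right_annihilator R \<sigma> I. b \<noteq> \<zero>"
proof -
  let ?A = "right_annihilator (skew_UP R \<sigma>) I"
  \<comment> \<open>\<open>P m\<close> says that \<open>m\<close> is the degree of some nonzero
    annihilating polynomial.\<close>
  define P where "P m \<longleftrightarrow> (\<exists>g\<in>?A. g m \<noteq> \<zero> \<and> (\<forall>j>m. g j = \<zero>))" for m
  have A: "?A \<subseteq> up R" by (auto simp: right_annihilator_def skew_UP_simps(1))
  have degree: "\<exists>m. h m \<noteq> \<zero> \<and> (\<forall>j>m. h j = \<zero>)" if h: "h \<in> ?A" "h i \<noteq> \<zero>" for h i
  proof -
    have "h \<in> up R" using h(1) A by blast
    then obtain n where n: "bound \<zero> n h" by fast
    let ?M = "{j. h j \<noteq> \<zero>}"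
    have "?M \<subseteq> {..n}" using n by (auto simp: bound_def not_le [symmetric])
    then have "finite ?M" by (rule finite_subset) simp
    with h(2) show ?thesis
      using Max_in [of ?M] Max_ge [of ?M] by (intro exI [of _ "Max ?M"]) fastforce
  qed
  obtain h i where "h \<in> ?A" "h i \<noteq> \<zero>"
    using nonzero zero_in_right_annihilator [OF I] unfolding zero_eq by fastforce
  then have "\<exists>m. P m" using degree unfolding P_def by blast
  then obtain m where m: "P m" and least: "\<And>l. l < m \<Longrightarrow> \<not> P l"
    using exists_least_iff [of P] by auto
  obtain g where gA: "g \<in> ?A" and gm: "g m \<noteq> \<zero>" and deg: "\<And>j. m < j \<Longrightarrow> g j = \<zero>"
    using m unfolding P_def by blast
  have g: "g \<in> up R" using gA A by blast
  \<comment> \<open>A nonzero coefficient would give \<open>h\<close> a degree below the least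
    one.\<close>
  have small: "h j = \<zero>" if h: "h \<in> ?A" and top: "\<And>j. m \<le> j \<Longrightarrow> h j = \<zero>" for h j
    using degree [OF h, of j] least top h unfolding P_def by (metis not_le)
  have lead: "c \<otimes> (\<sigma> ^^ k) (g j) = \<zero>"
    if c: "c \<in> carrier R" and z: "c \<otimes> (\<sigma> ^^ k) (g m) = \<zero>" for c k j
    using stable
  proof
    assume "skew_map \<sigma> ` ?A \<subseteq> ?A"
    \<comment> \<open>Scaling this polynomial by \<open>c\<close> kills its coefficient at
      \<open>m\<close>, so \<open>small\<close> applies.\<close>
    then have "(skew_map \<sigma> ^^ k) g \<in> ?A" using gA by (induct k) auto
    then have "(\<lambda>n. c \<otimes> (\<sigma> ^^ k) (g n)) \<in> ?A"
      using const_mult_in_right_annihilator [OF I c] by (simp add: skew_map_funpow)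
    then show ?thesis
      by (rule small) (use z c deg in \<open>auto simp: le_less\<close>)
  next
    assume comp: "compatible R \<sigma>"
    \<comment> \<open>\<open>shift\<close> removes the twist from \<open>z\<close>, so
      \<open>c g\<close> itself has no coefficient at \<open>m\<close>; afterwards it restores the
      twist.\<close>
    note shift = compatible_funpow [OF comp endo c mem_upD [OF g]]
    have "c \<otimes> g j = \<zero>"
      by (rule small [OF const_mult_in_right_annihilator [OF I c gA]])
        (use z shift c deg in \<open>auto simp: le_less\<close>)
    then show ?thesis by (simp add: shift)
  qed
  have "f \<otimes>\<^bsub>skew_UP R \<sigma>\<^esub> monom (skew_UP R \<sigma>) (g m) 0 = \<zero>\<^bsub>skew_UP R \<sigma>\<^esub>" if f: "f \<in> I" for f
  proof -
    have fS: "f \<in> up R" using right_ideal_subset [OF I] f by blast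
    have "f \<otimes>\<^bsub>skew_UP R \<sigma>\<^esub> g = \<zero>\<^bsub>skew_UP R \<sigma>\<^esub>" using gA f by (simp add: right_annihilator_def)
    \<comment> \<open>The product has coefficients
      \<open>f n \<otimes> (\<sigma> ^^ n) (g m)\<close>: the case \<open>j = m\<close> of
      \<open>mult_zero_coeff\<close>.\<close>
    then show ?thesis
      using mult_const [OF mem_upD [OF g] fS] mult_zero_coeff [OF fS g _ deg lead]
      by (simp add: zero_eq)
  qed
  then show ?thesis using gm mem_upD [OF g] by (auto simp: coeff_right_annihilator_def)
qed

end

theorem theorem2p1:
  fixes R :: "('a, 'm) ring_scheme" and \<sigma> :: "'a \<Rightarrow> 'a" and I :: "(nat \<Rightarrow> 'a) set"
  assumes "ring R"
    and "\<sigma> \<in> ring_hom R R"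
    and "right_ideal I (skew_UP R \<sigma>)"
    and "skew_map \<sigma> ` right_annihilator (skew_UP R \<sigma>) I \<subseteq> right_annihilator (skew_UP R \<sigma>) I
      \<or> compatible R \<sigma>"
    and "right_annihilator (skew_UP R \<sigma>) I \<noteq> {\<zero>\<^bsub>skew_UP R \<sigma>\<^esub>}"
  shows "coeff_right_annihilator R \<sigma> I \<noteq> {\<zero>\<^bsub>R\<^esub>}"
proof -
  interpret skew_poly R \<sigma>
    using assms(1,2) by (simp add: skew_poly_def skew_poly_axioms_def)
  show ?thesis using coeff_right_annihilator_nonzero [OF assms(3-5)] by blast
qed

end
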